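(* Let $n \ge 2$ be an integer and let $x$ be a real number in $[1,\infty)$. For real $y\ge 1$ put $$P_n(y) = \sum_{k=0}^{n-2}\binom{n}{k}y^k = 1+\binom{n}{1}y+\binom{n}{2}y^2+\cdots+\binom{n}{n-2}y^{n-2}.$$ Then $$x+1=\sqrt[n]{P_n(x)+x^{n-1}\sqrt[n]{P_n(x+(n-1))+(x+(n-1))^{n-1}\sqrt[n]{P_n(x+2(n-1))+(x+2(n-1))^{n-1}\sqrt[n]{\cdots}}}},$$ where the infinite nested radical denotes the limit of its finite truncations. That is, if for real $y\ge 1$ one defines $T_0(y)=0$ and $$T_{m+1}(y)=\sqrt[n]{P_n(y)+y^{n-1}\,T_m(y+n-1)}\qquad (m\ge 0),$$ then $\lim_{m\to\infty}T_m(x)$ exists and equals $x+1$.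
   Context: Here $\sqrt[n]{\cdot}$ denotes the non-negative real $n$th root of a non-negative real number, and $\binom{n}{k}$ is the binomial coefficient. For $n=2$ the polynomial $P_2$ is the constant $1$. The value of an infinite nested radical is the limit of the (monotonically increasing) sequence of finite nested radicals obtained by truncating after finitely many roots, i.e. by dropping everything from the next root onward. *)

theory Defs
  imports Complex_Main
begin

(* The natural-number subtraction is exact for n >= 2. *)
definition radical_poly :: "nat \<Rightarrow> real \<Rightarrow> real" where
  "radical_poly n y = (\<Sum>k=0..n-2. real (n choose k) * y ^ k)"

(* The nested radical starting at y, truncated after m roots. *)
primrec nested_radical :: "nat \<Rightarrow> nat \<Rightarrow> real \<Rightarrow> real" where
  "nested_radical n 0 y = 0"
| "nested_radical n (Suc m) y =
     root n (radical_poly n y + y ^ (n - 1) * nested_radical n m (y + (real n - 1)))"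

end

theory Submission
  imports Defs "HOL-Real_Asymp.Real_Asymp"
begin

(* The function y + 1 solves the functional equation f(y)^n = P_n(y) + y^(n-1) f(y+n-1), so by
   monotonicity it bounds every truncation from above. For the lower bound pass to the ratio
   r_m(y) = T_m(y) / (y+1), which lies in [0,1]: the functional equation makes r_(m+1)(y)^n a convex
   combination of 1 and r_m(y+n-1), so r_(m+1)(y)^n >= r_m(y+n-1). Each step thus takes an n-th root
   of the ratio, and the initial ratio at the m-th argument decays only like the reciprocal of a
   linear function of m, so its n^m-th root tends to 1. *)

lemma radical_poly_ge_1:
  assumes "0 \<le> y"
  shows "1 \<le> radical_poly n y"
proof -
  have "(\<Sum>k\<in>{0}. real (n choose k) * y ^ k) \<le> radical_poly n y"
    unfolding radical_poly_def by (rule sum_mono2) (use assms in auto)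
  then show ?thesis by simp
qed

text \<open>The two top terms of the binomial expansion of \<open>(y + 1) ^ n\<close>, absent from
  \<open>radical_poly n y\<close>, combine to y^(n-1) * (n + y). The factor y + n is the candidate
  solution y + 1 evaluated at the next argument y + (n - 1).\<close>

lemma radical_poly_functional_equation:
  assumes "2 \<le> n"
  shows "radical_poly n y + y ^ (n - 1) * (y + real n) = (y + 1) ^ n"
proof -
  obtain k where n: "n = Suc (Suc k)"
    using assms by (metis Suc_le_D numeral_2_eq_2 Suc_le_mono)
  have "(y + 1) ^ n = (\<Sum>i\<le>n. real (n choose i) * y ^ i)"
    by (simp add: binomial_ring)
  also have "\<dots> = (\<Sum>i\<le>k. real (n choose i) * y ^ i) + real n * y ^ Suc k + y ^ n"
    unfolding n by (subst sum.atMost_Suc, subst sum.atMost_Suc, subst binomial_Suc_n) simp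
  also have "(\<Sum>i\<le>k. real (n choose i) * y ^ i) = radical_poly n y"
    by (simp add: radical_poly_def n atMost_atLeast0)
  finally show ?thesis by (simp add: n algebra_simps)
qed

lemma nested_radical_le:
  assumes "2 \<le> n" "0 \<le> y"
  shows "nested_radical n m y \<le> y + 1"
  using assms(2)
proof (induction m arbitrary: y)
  case (Suc m)
  have "nested_radical n m (y + (real n - 1)) \<le> y + real n"
    using Suc.IH[of "y + (real n - 1)"] Suc.prems assms(1) by simp
  then have "radical_poly n y + y ^ (n - 1) * nested_radical n m (y + (real n - 1))
      \<le> radical_poly n y + y ^ (n - 1) * (y + real n)"
    using Suc.prems by (intro add_left_mono mult_left_mono) auto
  also have "\<dots> = (y + 1) ^ n"
    by (rule radical_poly_functional_equation[OF assms(1)])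
  finally have "nested_radical n (Suc m) y \<le> root n ((y + 1) ^ n)"
    using assms(1) by simp
  also have "\<dots> = y + 1"
    using Suc.prems assms(1) by (intro real_root_power_cancel) auto
  finally show ?case .
qed simp

text \<open>The base of the power is one more than the argument of the innermost root; that root is
  at least 1, so its ratio is at least the reciprocal of the base. The m roots around it give the
  exponent. Starting at \<open>Suc m\<close> avoids the empty truncation, whose ratio is 0.\<close>

lemma nested_radical_Suc_ge:
  assumes "2 \<le> n" "0 \<le> y"
  shows "(y + 1) * (y + 1 + real m * (real n - 1)) powr - (1 / real n ^ m)
    \<le> nested_radical n (Suc m) y"
  using assms(2)
proof (induction m arbitrary: y)
  case 0
  \<comment> \<open>With no outer roots the exponent is -1, so the claimed bound is exactly
    1.\<close>
  have "1 \<le> root n (radical_poly n y)"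
    using radical_poly_ge_1[OF 0] assms(1) by simp
  then show ?case
    using 0 by (simp add: powr_minus)
next
  case (Suc m)
  \<comment> \<open>The shift to y + (n - 1) with one root fewer leaves this base unchanged, so only
    the exponent differs between the induction hypothesis and the goal.\<close>
  define b where "b = y + 1 + real (Suc m) * (real n - 1)"
  define s where "s = b powr - (1 / real n ^ m)"
  have b: "1 \<le> b"
    using Suc.prems assms(1) by (simp add: b_def)
  have s: "0 < s" "s \<le> 1"
    using b by (auto simp: s_def powr_minus inverse_le_1_iff ge_one_powr_ge_zero)
  have IH: "(y + real n) * s \<le> nested_radical n (Suc m) (y + (real n - 1))"
    using Suc.IH[of "y + (real n - 1)"] Suc.prems assms(1)
    by (simp add: s_def b_def algebra_simps del: nested_radical.simps)
  have "s * (y + 1) ^ n = s * radical_poly n y + y ^ (n - 1) * ((y + real n) * s)"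
    unfolding radical_poly_functional_equation[OF assms(1), symmetric] by (simp add: algebra_simps)
  \<comment> \<open>The factor s \<le> 1 is dropped from the first summand; in the second it is
    absorbed by \<open>IH\<close>.\<close>
  also have "\<dots> \<le> radical_poly n y + y ^ (n - 1) * nested_radical n (Suc m) (y + (real n - 1))"
    using IH Suc.prems s radical_poly_ge_1[OF Suc.prems, of n]
    by (intro add_mono mult_left_mono mult_left_le_one_le) auto
  finally have "root n (s * (y + 1) ^ n) \<le> nested_radical n (Suc (Suc m)) y"
    using assms(1) by (subst nested_radical.simps(2)) simp
  moreover have "root n ((y + 1) ^ n) = y + 1"
    using Suc.prems assms(1) by (intro real_root_power_cancel) auto
  moreover have "root n s = b powr - (1 / real n ^ Suc m)"
    using s assms(1) by (simp add: root_powr_inverse s_def powr_powr field_simps)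
  ultimately show ?case
    by (simp add: real_root_mult b_def mult.commute del: nested_radical.simps)
qed

theorem mainTheorem1:
  fixes n :: nat and x :: real
  assumes "n \<ge> 2" and "x \<ge> 1"
  shows "(\<lambda>m. nested_radical n m x) \<longlonglongrightarrow> x + 1"
proof -
  define N where "N = real n"
  have N: "N > 1" using assms(1) by (simp add: N_def)
  have "(\<lambda>m. (x + 1) * (x + 1 + real m * (N - 1)) powr - (1 / N ^ m)) \<longlonglongrightarrow> x + 1"
    using N by real_asymp
  \<comment> \<open>The squeeze has the constant x + 1 above; it runs along \<open>Suc m\<close>
    because the lower bound needs at least one root.\<close>
  then have "(\<lambda>m. nested_radical n (Suc m) x) \<longlonglongrightarrow> x + 1"
    by (rule tendsto_sandwich[rotated 2, OF _ tendsto_const])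
      (use assms in \<open>auto simp: N_def intro!: always_eventually nested_radical_le nested_radical_Suc_ge
         simp del: nested_radical.simps\<close>)
  then show ?thesis by (rule LIMSEQ_imp_Suc)
qed

end
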